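(* Let $k\geq 1$ be an integer, $\rho>0$, and $\kappa=-1/\rho^2$. Let $\mu,\nu\in\mathbb{C}$ with $\mu\neq\nu$, and let $\varphi_\mu(r)$, $\varphi_\nu(r)$ be two radial eigenfunctions, with eigenvalues $\mu$ and $\nu$ respectively, of the hyperbolic Laplacian $$\triangle\varphi(r)=\varphi''(r)+\frac{k}{\rho}\coth\left(\frac{r}{\rho}\right)\varphi'(r),\qquad 0\leq r<\infty,$$ in the ball model of the hyperbolic $(k+1)$-dimensional space of constant sectional curvature $\kappa=-1/\rho^2<0$, and suppose $\varphi_\mu(0)=\varphi_\nu(0)=1$. Let $\alpha,\beta\in\mathbb{C}$ be complex numbers related to $\mu,\nu$ by the quadratic equations $$\mu=-\kappa(\alpha k-\alpha^2),\qquad \nu=-\kappa(\beta k-\beta^2),$$ and let $p=\max\{|\Im(\alpha)|,|\Im(\beta)|\}$. Then $\varphi_\nu(r)\neq\varphi_\mu(r)$ for every $r\in(0,\pi\rho/(2p)]$, where for $p=0$ this interval is understood as $(0,\infty)$.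
   Context: The variable $r$ is the hyperbolic distance to the origin. A radial eigenfunction with eigenvalue $\lambda\in\mathbb{C}$ is a complex-valued twice continuously differentiable function on the hyperbolic space depending only on $r$, regarded as a function $\varphi:[0,\infty)\to\mathbb{C}$ (in particular continuous at $r=0$), satisfying $\triangle\varphi+\lambda\varphi=0$, i.e. $\varphi''(r)+\frac{k}{\rho}\coth\left(\frac{r}{\rho}\right)\varphi'(r)+\lambda\varphi(r)=0$ for $r>0$. For each $\lambda\in\mathbb{C}$ there is exactly one such function with value $1$ at $r=0$; it is denoted $\varphi_\lambda$. *)

theory Defs
  imports "HOL-Analysis.Analysis"
begin

text \<open>
  Ball model of the hyperbolic space of constant curvature \<open>- 1 / \<rho>\<^sup>2\<close>: the open ball
  \<open>ball 0 \<rho>\<close> of a Euclidean space with the metric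
  \<open>4 \<bar>dx\<bar>\<^sup>2 / (1 - \<bar>x\<bar>\<^sup>2 / \<rho>\<^sup>2)\<^sup>2\<close>. Integrating \<open>2 / (1 - s\<^sup>2 / \<rho>\<^sup>2)\<close> over \<open>[0, \<bar>x\<bar>]\<close>
  gives the following distance to the origin, equal to \<open>2 \<rho> artanh (\<bar>x\<bar> / \<rho>)\<close>.
\<close>

definition hyp_radius :: "real \<Rightarrow> 'a::euclidean_space \<Rightarrow> real" where
  "hyp_radius \<rho> x = \<rho> * ln ((\<rho> + norm x) / (\<rho> - norm x))"

definition C2_on :: "('a::euclidean_space \<Rightarrow> 'b::real_normed_vector) \<Rightarrow> 'a set \<Rightarrow> bool" where
  "C2_on f S \<longleftrightarrow>
    (\<exists>(f' :: 'a \<Rightarrow> 'a \<Rightarrow>\<^sub>L 'b) (f'' :: 'a \<Rightarrow> 'a \<Rightarrow>\<^sub>L 'a \<Rightarrow>\<^sub>L 'b).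
      (\<forall>x\<in>S. (f has_derivative blinfun_apply (f' x)) (at x)) \<and>
      (\<forall>x\<in>S. (f' has_derivative blinfun_apply (f'' x)) (at x)) \<and>
      continuous_on S f'')"

text \<open>
  The hyperbolic Laplacian of a radial function, in dimension \<open>k + 1\<close>;
  \<open>cosh (r / \<rho>) / sinh (r / \<rho>)\<close> is \<open>coth (r / \<rho>)\<close>.
\<close>

definition radial_laplacian :: "nat \<Rightarrow> real \<Rightarrow> (real \<Rightarrow> complex) \<Rightarrow> real \<Rightarrow> complex" where
  "radial_laplacian k \<rho> \<phi> r =
     vector_derivative (\<lambda>s. vector_derivative \<phi> (at s)) (at r)
     + complex_of_real (real k / \<rho> * (cosh (r / \<rho>) / sinh (r / \<rho>)))
         * vector_derivative \<phi> (at r)"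

text \<open>
  The type argument is the Euclidean space that contains the ball model; the \<open>k\<close> of the
  Laplacian is one less than its dimension. Only the values of \<open>\<phi>\<close> on \<open>[0, \<infinity>)\<close> matter. The first
  conjunct says that the function \<open>x \<mapsto> \<phi> (r x)\<close> is twice continuously differentiable on hyperbolic
  space, including the origin; it implies that the derivatives in the radial Laplacian exist for
  \<open>r > 0\<close>, as \<open>\<phi> r\<close> is the value of that function at \<open>\<rho> tanh (r / (2 \<rho>)) e\<close> for any unit
  vector \<open>e\<close>.
\<close>

definition radial_eigenfunction ::
    "'a::euclidean_space itself \<Rightarrow> real \<Rightarrow> complex \<Rightarrow> (real \<Rightarrow> complex) \<Rightarrow> bool" where
  "radial_eigenfunction _ \<rho> \<mu> \<phi> \<longleftrightarrow>
     C2_on (\<lambda>x::'a. \<phi> (hyp_radius \<rho> x)) (ball 0 \<rho>) \<and>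
     (\<forall>r>0. radial_laplacian (DIM('a) - 1) \<rho> \<phi> r + \<mu> * \<phi> r = 0)"

end

theory Submission
  imports Defs
begin

text \<open>
  With \<open>h = cosh r - sinh r * cos t\<close>, the horospherical integral of \<open>h\<close> raised to the power \<open>- \<alpha>\<close>,
  weighted by \<open>sin\<close> to the power \<open>k - 1\<close> over \<open>t \<in> [0, \<pi>]\<close>, is the radial eigenfunction of
  eigenvalue \<open>\<alpha> k - \<alpha>\<^sup>2\<close> up to a constant that does not depend on \<open>\<alpha>\<close>. Symmetrizing under
  \<open>\<alpha> \<leftrightarrow> k - \<alpha>\<close> turns it into the integral of \<open>cosh ((\<alpha> - k/2) s)\<close> against a positive weight, where
  \<open>s = ln h\<close> lies in \<open>[-r, r]\<close>. The difference of two such cosines is \<open>2 sinh (u s) sinh (v s)\<close>;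
  for \<open>0 < s < r\<close> the imaginary parts of \<open>u s\<close> and \<open>v s\<close> are less than \<open>\<pi>/2\<close> in absolute value, which keeps
  each factor in a fixed quadrant and their product in a fixed half-plane. Hence the difference of the
  integrals does not vanish.
\<close>

subsection \<open>Solutions of the radial equation that are regular at the origin\<close>

text \<open>The radial equation in curvature -1 as a first-order system, with \<open>g\<close> in
  the role of the derivative of \<open>f\<close>. The data at the origin are one-sided limits
  because \<open>cosh r / sinh r\<close> is singular there and the values at
  \<open>r \<le> 0\<close> are left free.\<close>

definition regular_solution ::
    "nat \<Rightarrow> complex \<Rightarrow> complex \<Rightarrow> (real \<Rightarrow> complex) \<Rightarrow> (real \<Rightarrow> complex) \<Rightarrow> bool" where
  "regular_solution k l c f g \<longleftrightarrow>
     (\<forall>r>0. (f has_vector_derivative g r) (at r) \<and>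
       (g has_vector_derivative - (of_real (real k * (cosh r / sinh r)) * g r + l * f r)) (at r)) \<and>
     (f \<longlongrightarrow> c) (at_right 0) \<and> (g \<longlongrightarrow> 0) (at_right 0)"

lemma regular_solution_cmult:
  assumes "regular_solution k l c f g"
  shows "regular_solution k l (a * c) (\<lambda>r. a * f r) (\<lambda>r. a * g r)"
proof -
  have "((\<lambda>r. a * g r) has_vector_derivative
      - (of_real (real k * (cosh r / sinh r)) * (a * g r) + l * (a * f r))) (at r)" if "r > 0" for r
  proof -
    have "((\<lambda>r. a * g r) has_vector_derivative
      a * - (of_real (real k * (cosh r / sinh r)) * g r + l * f r)) (at r)"
      using assms that unfolding regular_solution_def by (blast intro: has_vector_derivative_mult_right)
    then show ?thesis by (simp add: algebra_simps)
  qed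
  then show ?thesis
    using assms unfolding regular_solution_def
    by (auto intro!: has_vector_derivative_mult_right tendsto_eq_intros)
qed

lemma regular_solution_diff:
  assumes "regular_solution k l c f g" and "regular_solution k l d u v"
  shows "regular_solution k l (c - d) (\<lambda>r. f r - u r) (\<lambda>r. g r - v r)"
proof -
  have "((\<lambda>r. g r - v r) has_vector_derivative
      - (of_real (real k * (cosh r / sinh r)) * (g r - v r) + l * (f r - u r))) (at r)"
    if "r > 0" for r
  proof -
    have "((\<lambda>r. g r - v r) has_vector_derivative
      - (of_real (real k * (cosh r / sinh r)) * g r + l * f r)
      - - (of_real (real k * (cosh r / sinh r)) * v r + l * u r)) (at r)"
      using assms that unfolding regular_solution_def by (blast intro: has_vector_derivative_diff)
    then show ?thesis by (simp add: algebra_simps diff_divide_distrib)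
  qed
  then show ?thesis
    using assms unfolding regular_solution_def
    by (auto intro!: has_vector_derivative_diff tendsto_diff tendsto_eq_intros)
qed

text \<open>Gronwall for the energy \<open>\<bar>f\<bar>\<^sup>2 + \<bar>f'\<bar>\<^sup>2\<close>; the singular term only dissipates it.\<close>

lemma regular_solution_zero:
  assumes sol: "regular_solution k l 0 f g" and "r > 0"
  shows "f r = 0"
proof -
  define C where "C = 1 + norm l"
  define E where "E r = f r \<bullet> f r + g r \<bullet> g r" for r
  define E' where "E' r = 2 * (f r \<bullet> g r)
      + 2 * (g r \<bullet> - (of_real (real k * (cosh r / sinh r)) * g r + l * f r))" for r
  have E: "(E has_vector_derivative E' x) (at x)" if "x > 0" for x
  proof -
    have "(f has_vector_derivative g x) (at x)"
      and "(g has_vector_derivative - (of_real (real k * (cosh x / sinh x)) * g x + l * f x)) (at x)"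
      using sol that unfolding regular_solution_def by auto
    note d = bounded_bilinear.has_vector_derivative[OF bounded_bilinear_inner]
    show ?thesis
      unfolding E_def[abs_def] E'_def
      by (rule has_vector_derivative_eq_rhs, rule has_vector_derivative_add; (rule d; fact)?)
         (simp add: inner_commute)
  qed
  \<comment> \<open>The singular coefficient enters as \<open>- b * (g x \<bullet> g x)\<close> with
    \<open>b \<ge> 0\<close> and is dropped, so \<open>C\<close> does not depend on the distance to
    the singularity.\<close>
  have E'_le: "E' x \<le> C * E x" if "x > 0" for x
  proof -
    define b where "b = real k * (cosh x / sinh x)"
    have "b \<ge> 0" using that by (simp add: b_def)
    have "g x \<bullet> - (of_real b * g x + l * f x) = - b * (g x \<bullet> g x) - g x \<bullet> (l * f x)"
      by (simp add: inner_diff_right scaleR_conv_of_real[symmetric])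
    also have "\<dots> \<le> norm (g x) * (norm l * norm (f x))"
      using Cauchy_Schwarz_ineq2[of "g x" "l * f x"] \<open>b \<ge> 0\<close>
      by (simp add: norm_mult) (smt (verit) inner_ge_zero mult_nonneg_nonneg)
    finally have 1: "g x \<bullet> - (of_real b * g x + l * f x) \<le> norm l * (norm (f x) * norm (g x))"
      by (simp add: mult_ac)
    have 2: "f x \<bullet> g x \<le> norm (f x) * norm (g x)" by (rule norm_cauchy_schwarz)
    have 3: "2 * (norm (f x) * norm (g x)) \<le> E x"
      using sum_squares_bound[of "norm (f x)" "norm (g x)"]
      by (simp add: E_def dot_square_norm)
    have "E' x \<le> C * (2 * (norm (f x) * norm (g x)))"
      using 1 2 unfolding E'_def C_def b_def by (simp add: algebra_simps)
    also have "\<dots> \<le> C * E x" using 3 by (intro mult_left_mono) (auto simp: C_def)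
    finally show ?thesis .
  qed
  \<comment> \<open>Integrating factor: \<open>F\<close> is nonincreasing on the open half-line and
    tends to 0 at the origin, so \<open>F r \<le> 0\<close>, while \<open>E\<close> is a sum of
    squares.\<close>
  define F where "F x = exp (- C * x) * E x" for x
  have F: "(F has_real_derivative exp (- C * x) * (E' x - C * E x)) (at x)" if "x > 0" for x
    unfolding F_def
    using E[OF that, folded has_real_derivative_iff_has_vector_derivative]
    by (auto intro!: derivative_eq_intros simp: algebra_simps)
  have "F r \<le> F e" if "0 < e" "e < r" for e
  proof (rule DERIV_nonpos_imp_nonincreasing[where f = F])
    show "\<exists>y. (F has_real_derivative y) (at x) \<and> y \<le> 0" if "e \<le> x" "x \<le> r" for x
      using F[of x] E'_le[of x] that \<open>0 < e\<close> by (fastforce intro: mult_nonneg_nonpos)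
  qed (use that in simp)
  then have "eventually (\<lambda>e. F r \<le> F e) (at_right 0)"
    using eventually_at_right[OF \<open>r > 0\<close>] \<open>r > 0\<close> by blast
  moreover have "(f \<longlongrightarrow> 0) (at_right 0)" and "(g \<longlongrightarrow> 0) (at_right 0)"
    using sol unfolding regular_solution_def by auto
  then have "(F \<longlongrightarrow> exp (- C * 0) * ((0::complex) \<bullet> 0 + (0::complex) \<bullet> 0)) (at_right 0)"
    unfolding F_def E_def by (intro tendsto_intros)
  ultimately have "F r \<le> 0"
    by (intro tendsto_lowerbound[where F = "at_right 0" and f = F]) auto
  then have "E r \<le> 0" by (simp add: F_def mult_le_0_iff)
  then show ?thesis
    unfolding E_def by (smt (verit) inner_ge_zero inner_gt_zero_iff)
qed

lemma regular_solution_unique: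
  assumes "regular_solution k l c f g" and "regular_solution k l c u v" and "r > 0"
  shows "f r = u r"
  using regular_solution_zero[OF _ \<open>r > 0\<close>] regular_solution_diff[OF assms(1,2)] by fastforce

section \<open>From eigenfunctions on the ball to the radial equation\<close>

lemma hyp_radius_tanh:
  fixes x :: "'a::euclidean_space"
  assumes "norm x = 1" and "\<rho> > 0" and "r \<ge> 0"
  shows "hyp_radius \<rho> ((\<rho> * tanh (r / 2)) *\<^sub>R x) = \<rho> * r"
proof -
  define t where "t = tanh (r / 2)"
  have "t \<ge> 0" using assms(3) by (simp add: t_def)
  have "hyp_radius \<rho> ((\<rho> * t) *\<^sub>R x) = \<rho> * ln ((\<rho> * (1 + t)) / (\<rho> * (1 - t)))"
    using assms \<open>t \<ge> 0\<close> by (simp add: hyp_radius_def algebra_simps)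
  also have "(\<rho> * (1 + t)) / (\<rho> * (1 - t)) = (1 + t) / (1 - t)"
    using assms(2) by (intro mult_divide_mult_cancel_left) simp
  also have "ln ((1 + t) / (1 - t)) = r"
    using artanh_tanh_real[of "r / 2"] by (simp add: artanh_def t_def)
  finally show ?thesis by (simp add: t_def)
qed

text \<open>Measuring the radius in units of \<open>\<rho>\<close> normalizes the curvature to -1
  and multiplies the eigenvalue by \<open>\<rho>\<^sup>2\<close>. The behaviour at the origin comes
  from smoothness on the ball: along a diameter the function is even, so its derivative vanishes at
  the centre.\<close>

lemma regular_solution_radial_eigenfunction:
  assumes "\<rho> > 0" and dim: "DIM('a::euclidean_space) = k + 1"
    and eigen: "radial_eigenfunction TYPE('a) \<rho> \<mu> \<phi>"
  obtains g where "regular_solution k (of_real (\<rho>\<^sup>2) * \<mu>) (\<phi> 0) (\<lambda>r. \<phi> (\<rho> * r)) g"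
proof -
  obtain f' :: "'a \<Rightarrow> 'a \<Rightarrow>\<^sub>L complex" and f'' :: "'a \<Rightarrow> 'a \<Rightarrow>\<^sub>L 'a \<Rightarrow>\<^sub>L complex" where
    f': "\<And>x. x \<in> ball 0 \<rho> \<Longrightarrow> ((\<lambda>x::'a. \<phi> (hyp_radius \<rho> x)) has_derivative blinfun_apply (f' x)) (at x)"
    and f'': "\<And>x. x \<in> ball 0 \<rho> \<Longrightarrow> (f' has_derivative blinfun_apply (f'' x)) (at x)"
    using eigen unfolding radial_eigenfunction_def C2_on_def by blast
  obtain e :: 'a where "e \<in> Basis" by fastforce
  then have [simp]: "norm e = 1" by simp
  \<comment> \<open>Restriction to a diameter: for \<open>\<bar>t\<bar> < \<rho>\<close>, on both
    sides of 0, it involves \<open>\<phi>\<close> at nonnegative arguments only.\<close>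
  define F where "F t = \<phi> (hyp_radius \<rho> (t *\<^sub>R e))" for t
  define F' where "F' t = blinfun_apply (f' (t *\<^sub>R e)) e" for t
  define F'' where "F'' t = blinfun_apply (blinfun_apply (f'' (t *\<^sub>R e)) e) e" for t
  have line: "((\<lambda>t. t *\<^sub>R e) has_vector_derivative e) (at t)" for t
    by (auto intro!: derivative_eq_intros)
  have F: "(F has_vector_derivative F' t) (at t)" if "\<bar>t\<bar> < \<rho>" for t
    using vector_derivative_diff_chain_within[OF line[of t], where g' = "blinfun_apply (f' (t *\<^sub>R e))"]
      f'[of "t *\<^sub>R e"] that
    by (auto simp: F_def[abs_def] F'_def o_def intro: has_derivative_at_withinI)
  have F': "(F' has_vector_derivative F'' t) (at t)" if "\<bar>t\<bar> < \<rho>" for t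
  proof -
    have "((\<lambda>t. f' (t *\<^sub>R e)) has_vector_derivative f'' (t *\<^sub>R e) e) (at t)"
      using vector_derivative_diff_chain_within[OF line[of t], where g = f' and g' = "blinfun_apply (f'' (t *\<^sub>R e))"]
        f''[of "t *\<^sub>R e"] that
      by (auto simp: o_def intro: has_derivative_at_withinI)
    from bounded_linear.has_vector_derivative[OF blinfun.bounded_linear_left this]
    show ?thesis by (simp add: F'_def[abs_def] F''_def)
  qed
  have "F' 0 = 0"
  proof -
    have even: "F (- t) = F t" for t by (simp add: F_def hyp_radius_def)
    have "((\<lambda>t. F (- t)) has_vector_derivative - F' 0) (at 0)"
      using vector_diff_chain_at[OF has_vector_derivative_minus[OF has_vector_derivative_id], of F "F' 0" 0]
        F[of 0] \<open>\<rho> > 0\<close> by (simp add: o_def)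
    then have "(F has_vector_derivative - F' 0) (at 0)" by (simp only: even)
    then have "- F' 0 = F' 0"
      by (rule vector_derivative_unique_at) (use F[of 0] \<open>\<rho> > 0\<close> in simp)
    then show ?thesis by simp
  qed
  \<comment> \<open>\<open>T\<close> sends the rescaled hyperbolic radius to the Euclidean one. It
    is smooth on the whole line, so \<open>F (T r)\<close> is twice differentiable across 0, and it
    agrees with \<open>\<phi> (\<rho> * r)\<close> for \<open>r \<ge> 0\<close>.\<close>
  define T where "T r = \<rho> * tanh (r / 2)" for r
  define T' where "T' r = \<rho> / 2 * (1 - (tanh (r / 2))\<^sup>2)" for r
  have T_less: "\<bar>T r\<bar> < \<rho>" for r
  proof -
    have "\<rho> * \<bar>tanh (r / 2)\<bar> < \<rho> * 1"
      using \<open>\<rho> > 0\<close> tanh_real_bounds[of "r / 2"] by (intro mult_strict_left_mono) auto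
    then show ?thesis using \<open>\<rho> > 0\<close> by (simp add: T_def abs_mult)
  qed
  have T: "(T has_vector_derivative T' r) (at r)" for r
    unfolding T_def T'_def has_real_derivative_iff_has_vector_derivative[symmetric]
    using cosh_real_nonzero by (auto intro!: derivative_eq_intros simp: field_simps)
  have "((\<lambda>r. tanh (r / 2)) has_real_derivative (1 - (tanh (r / 2))\<^sup>2) / 2) (at r)" for r
    using cosh_real_nonzero by (auto intro!: derivative_eq_intros)
  then have "(\<lambda>r. tanh (r / 2)) differentiable (at r)" for r :: real
    unfolding real_differentiable_def by blast
  then have T': "T' differentiable (at r)" for r
    unfolding T'_def by (intro derivative_intros)
  define g where "g r = T' r *\<^sub>R F' (T r)" for r
  have FT: "((\<lambda>r. F (T r)) has_vector_derivative g r) (at r)" for r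
    unfolding g_def using vector_diff_chain_at[OF T[of r] F[OF T_less[of r]]] by (simp only: o_def)
  \<comment> \<open>Only the existence of the second derivative is established here, at 0 too; its
    value for \<open>r > 0\<close> is read off from the eigenvalue equation in
    \<open>D_eq\<close>.\<close>
  obtain D where D: "\<And>r. (g has_vector_derivative D r) (at r)"
  proof -
    have "(\<lambda>r. F' (T r)) differentiable (at r)" for r
      using vector_diff_chain_at[OF T[of r] F'[OF T_less[of r]], THEN differentiableI_vector]
      by (simp add: o_def)
    then have "g differentiable (at r)" for r
      unfolding g_def using T' by (intro differentiable_scaleR)
    then show thesis using that[of "\<lambda>r. vector_derivative g (at r)"]
      by (simp add: vector_derivative_works)
  qed
  have FT_eq: "F (T r) = \<phi> (\<rho> * r)" if "r \<ge> 0" for r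
    using that hyp_radius_tanh[of e \<rho> r] \<open>\<rho> > 0\<close> by (simp add: F_def T_def)
  have scaled: "((\<lambda>r. \<phi> (\<rho> * r)) has_vector_derivative g r) (at r)" if "r > 0" for r
    using has_vector_derivative_transform_within_open[OF FT, of "{0<..}" r] that FT_eq by auto
  have div: "((\<lambda>s. s / \<rho>) has_vector_derivative 1 / \<rho>) (at s)" for s
    unfolding has_real_derivative_iff_has_vector_derivative[symmetric]
    using \<open>\<rho> > 0\<close> by (auto intro!: derivative_eq_intros)
  have \<phi>: "(\<phi> has_vector_derivative (1 / \<rho>) *\<^sub>R g (s / \<rho>)) (at s)" if "s > 0" for s
  proof -
    have "s / \<rho> > 0" using that \<open>\<rho> > 0\<close> by simp
    from vector_diff_chain_at[OF div[of s] scaled[OF this]]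
    show ?thesis using \<open>\<rho> > 0\<close> by (simp add: o_def)
  qed
  have \<phi>': "((\<lambda>s. vector_derivative \<phi> (at s)) has_vector_derivative (1 / \<rho>) *\<^sub>R (1 / \<rho>) *\<^sub>R D (s / \<rho>)) (at s)"
    if "s > 0" for s
  proof (rule has_vector_derivative_transform_within_open)
    show "((\<lambda>s. (1 / \<rho>) *\<^sub>R g (s / \<rho>)) has_vector_derivative (1 / \<rho>) *\<^sub>R (1 / \<rho>) *\<^sub>R D (s / \<rho>)) (at s)"
      using bounded_linear.has_vector_derivative[OF bounded_linear_scaleR_right[of "1 / \<rho>"] vector_diff_chain_at[OF div[of s] D]]
      by (simp only: o_def)
    show "s \<in> {0<..}" "open {0::real<..}" using that by auto
    show "(1 / \<rho>) *\<^sub>R g (x / \<rho>) = vector_derivative \<phi> (at x)" if "x \<in> {0<..}" for x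
      using \<phi>[THEN vector_derivative_at, of x] that by simp
  qed
  have D_eq: "D r = - (of_real (real k * (cosh r / sinh r)) * g r + of_real (\<rho>\<^sup>2) * \<mu> * \<phi> (\<rho> * r))"
    if "r > 0" for r
  proof -
    have "\<rho> * r > 0" using that \<open>\<rho> > 0\<close> by simp
    moreover have "\<rho> * r / \<rho> = r" using \<open>\<rho> > 0\<close> by simp
    ultimately have "vector_derivative \<phi> (at (\<rho> * r)) = (1 / \<rho>) *\<^sub>R g r"
      and "vector_derivative (\<lambda>s. vector_derivative \<phi> (at s)) (at (\<rho> * r))
        = (1 / \<rho>) *\<^sub>R (1 / \<rho>) *\<^sub>R D r"
      using \<phi>[THEN vector_derivative_at] \<phi>'[THEN vector_derivative_at] by metis+
    moreover have "radial_laplacian k \<rho> \<phi> (\<rho> * r) + \<mu> * \<phi> (\<rho> * r) = 0"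
      using eigen \<open>\<rho> * r > 0\<close> unfolding radial_eigenfunction_def dim add_diff_cancel_right' by blast
    ultimately have "(1 / \<rho>) *\<^sub>R (1 / \<rho>) *\<^sub>R D r
        + of_real (real k / \<rho> * (cosh r / sinh r)) * ((1 / \<rho>) *\<^sub>R g r) + \<mu> * \<phi> (\<rho> * r) = 0"
      unfolding radial_laplacian_def using \<open>\<rho> * r / \<rho> = r\<close> by (simp only:)
    then have "\<rho>\<^sup>2 *\<^sub>R ((1 / \<rho>) *\<^sub>R (1 / \<rho>) *\<^sub>R D r
        + of_real (real k / \<rho> * (cosh r / sinh r)) * ((1 / \<rho>) *\<^sub>R g r) + \<mu> * \<phi> (\<rho> * r)) = 0" by simp
    moreover have "\<rho>\<^sup>2 *\<^sub>R ((1 / \<rho>) *\<^sub>R (1 / \<rho>) *\<^sub>R D r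
        + of_real (real k / \<rho> * (cosh r / sinh r)) * ((1 / \<rho>) *\<^sub>R g r) + \<mu> * \<phi> (\<rho> * r))
      = D r + (of_real (real k * (cosh r / sinh r)) * g r + of_real (\<rho>\<^sup>2) * \<mu> * \<phi> (\<rho> * r))"
      using \<open>\<rho> > 0\<close> by (simp add: scaleR_conv_of_real power2_eq_square distrib_left)
    ultimately show ?thesis unfolding eq_neg_iff_add_eq_0 by metis
  qed
  have right_limit: "(h \<longlongrightarrow> h 0) (at_right 0)"
    if "(h has_vector_derivative h') (at 0)" for h :: "real \<Rightarrow> complex" and h'
    using has_vector_derivative_continuous[OF that]
    unfolding continuous_at by (rule tendsto_mono[OF at_le[OF subset_UNIV]])
  have "((\<lambda>r. F (T r)) \<longlongrightarrow> \<phi> 0) (at_right 0)"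
    using right_limit[OF FT] FT_eq[of 0] by simp
  moreover have "eventually (\<lambda>r. F (T r) = \<phi> (\<rho> * r)) (at_right 0)"
    using FT_eq by (simp add: eventually_at_filter)
  ultimately have "((\<lambda>r. \<phi> (\<rho> * r)) \<longlongrightarrow> \<phi> 0) (at_right 0)"
    by (rule Lim_transform_eventually)
  moreover have "(g \<longlongrightarrow> 0) (at_right 0)"
    using right_limit[OF D] \<open>F' 0 = 0\<close> by (simp add: g_def[of 0] T_def)
  moreover have "(g has_vector_derivative
      - (of_real (real k * (cosh r / sinh r)) * g r + of_real (\<rho>\<^sup>2) * \<mu> * \<phi> (\<rho> * r))) (at r)"
    if "r > 0" for r
    using D[of r] unfolding D_eq[OF that] .
  ultimately have "regular_solution k (of_real (\<rho>\<^sup>2) * \<mu>) (\<phi> 0) (\<lambda>r. \<phi> (\<rho> * r)) g"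
    unfolding regular_solution_def using scaled by blast
  then show thesis by (rule that)
qed

subsection \<open>Horospherical integrals\<close>

text \<open>In curvature -1, the logarithm of this quantity is the Busemann function of a boundary
  point, taken at distance \<open>r\<close> from the origin in a direction at angle \<open>t\<close>
  to that boundary point.\<close>

definition horo :: "real \<Rightarrow> real \<Rightarrow> real" where
  "horo r t = cosh r - sinh r * cos t"

text \<open>A complex power of \<open>horo r t\<close>. The base is positive, so the real logarithm
  serves and no branch has to be tracked.\<close>

definition horo_cpow :: "complex \<Rightarrow> real \<Rightarrow> real \<Rightarrow> complex" where
  "horo_cpow a r t = exp (a * of_real (ln (horo r t)))"

text \<open>Unnormalized Harish-Chandra integral of a spherical function:
  \<open>sin t ^ (k - 1)\<close> is the density of the polar angle on the boundary sphere of
  dimension \<open>k\<close>.\<close>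

definition spherical_integral :: "nat \<Rightarrow> complex \<Rightarrow> real \<Rightarrow> complex" where
  "spherical_integral k a r = integral {0..pi} (\<lambda>t. horo_cpow (- a) r t * of_real (sin t ^ (k - 1)))"

definition spherical_integral_deriv :: "nat \<Rightarrow> complex \<Rightarrow> real \<Rightarrow> complex" where
  "spherical_integral_deriv k a r = integral {0..pi}
     (\<lambda>t. - a * of_real (sinh r - cosh r * cos t) * horo_cpow (- a - 1) r t * of_real (sin t ^ (k - 1)))"

lemma horo_bounds:
  assumes "r \<ge> 0"
  shows "exp (- r) \<le> horo r t" and "horo r t \<le> exp r"
proof -
  have "sinh r * cos t \<le> sinh r * 1" and "sinh r * -1 \<le> sinh r * cos t"
    using assms by (intro mult_left_mono; simp)+
  then show "exp (- r) \<le> horo r t" and "horo r t \<le> exp r"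
    using cosh_minus_sinh[of r] cosh_plus_sinh[of r] by (auto simp: horo_def)
qed

lemma horo_minus: "horo (- r) t = horo r (pi - t)"
  by (simp add: horo_def)

text \<open>Negative \<open>r\<close> is reflected to positive \<open>r\<close> by
  \<open>horo_minus\<close>. It is included so that the integrals are differentiable at
  \<open>r = 0\<close> from both sides.\<close>

lemma horo_pos: "horo r t > 0"
proof (cases "r \<ge> 0")
  case True
  show ?thesis using less_le_trans[OF exp_gt_zero horo_bounds(1)[OF True]] .
next
  case False
  then show ?thesis
    using less_le_trans[OF exp_gt_zero horo_bounds(1)[of "-r" "pi - t"]] by (simp add: horo_minus)
qed

section \<open>Differentiation of the horospherical integrals\<close>

lemma continuous_horo [continuous_intros]:
  fixes A :: "'b::t2_space set"
  shows "continuous_on A f \<Longrightarrow> continuous_on A g \<Longrightarrow> continuous_on A (\<lambda>x. horo (f x) (g x))"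
  unfolding horo_def by (intro continuous_intros continuous_on_cos)

lemma continuous_horo_cpow [continuous_intros]:
  fixes A :: "'b::t2_space set"
  shows "continuous_on A f \<Longrightarrow> continuous_on A g \<Longrightarrow> continuous_on A (\<lambda>x. horo_cpow a (f x) (g x))"
  unfolding horo_cpow_def by (intro continuous_intros) (simp_all add: horo_pos[THEN less_imp_neq, symmetric])

lemma horo_cpow_add: "horo_cpow (a + b) r t = horo_cpow a r t * horo_cpow b r t"
  by (simp add: horo_cpow_def ring_distribs exp_add)

lemma horo_cpow_1 [simp]: "horo_cpow 1 r t = of_real (horo r t)"
  using horo_pos[of r t] by (simp add: horo_cpow_def exp_of_real)

lemma horo_cpow_plus_1: "horo_cpow (a + 1) r t = of_real (horo r t) * horo_cpow a r t"
  by (simp add: horo_cpow_add mult.commute)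

text \<open>With both arguments variable, one rule gives the \<open>r\<close>-derivatives under the
  integral sign and the \<open>t\<close>-derivative of the boundary term. The division by
  \<open>horo\<close> in the logarithmic derivative lowers the exponent by 1.\<close>

lemma has_vector_derivative_horo_cpow:
  assumes "(h has_real_derivative h') (at x within A)"
    and "(g has_real_derivative g') (at x within A)"
  shows "((\<lambda>x. horo_cpow a (h x) (g x)) has_vector_derivative
    a * of_real ((sinh (h x) - cosh (h x) * cos (g x)) * h' + sinh (h x) * sin (g x) * g')
      * horo_cpow (a - 1) (h x) (g x)) (at x within A)"
proof -
  have "((\<lambda>x. ln (horo (h x) (g x))) has_real_derivative
    ((sinh (h x) - cosh (h x) * cos (g x)) * h' + sinh (h x) * sin (g x) * g') / horo (h x) (g x))
    (at x within A)"
    using assms horo_pos[of "h x" "g x"] unfolding horo_def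
    by (auto intro!: derivative_eq_intros simp: field_simps)
  then have "((\<lambda>x. a * of_real (ln (horo (h x) (g x)))) has_vector_derivative
    a * of_real (((sinh (h x) - cosh (h x) * cos (g x)) * h' + sinh (h x) * sin (g x) * g') / horo (h x) (g x)))
    (at x within A)"
    by (intro has_vector_derivative_mult_right has_vector_derivative_of_real)
       (simp add: has_real_derivative_iff_has_vector_derivative)
  from field_vector_diff_chain_within[OF this DERIV_exp[THEN has_field_derivative_at_within]]
  have "((\<lambda>x. horo_cpow a (h x) (g x)) has_vector_derivative
    a * of_real (((sinh (h x) - cosh (h x) * cos (g x)) * h' + sinh (h x) * sin (g x) * g') / horo (h x) (g x))
      * horo_cpow a (h x) (g x)) (at x within A)"
    by (simp only: o_def horo_cpow_def)
  then show ?thesis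
    using horo_cpow_plus_1[of "a - 1" "h x" "g x"] horo_pos[of "h x" "g x"]
    by (simp add: mult.assoc)
qed

lemma has_vector_derivative_spherical_integral:
  "(spherical_integral k a has_vector_derivative spherical_integral_deriv k a r) (at r)"
proof -
  have "((\<lambda>r. integral (cbox 0 pi) (\<lambda>t. horo_cpow (- a) r t * of_real (sin t ^ (k - 1)))) has_vector_derivative
     integral (cbox 0 pi) (\<lambda>t. - a * of_real (sinh r - cosh r * cos t) * horo_cpow (- a - 1) r t * of_real (sin t ^ (k - 1))))
     (at r within UNIV)"
  proof (rule leibniz_rule_vector_derivative)
    show "((\<lambda>r. horo_cpow (- a) r t * of_real (sin t ^ (k - 1))) has_vector_derivative
       - a * of_real (sinh r - cosh r * cos t) * horo_cpow (- a - 1) r t * of_real (sin t ^ (k - 1)))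
       (at r within UNIV)" for r t
      by (intro has_vector_derivative_mult_left)
         (use has_vector_derivative_horo_cpow[of "\<lambda>r. r" 1 r UNIV "\<lambda>_. t" 0 "- a"] in simp)
  qed (auto intro!: integrable_continuous_real continuous_intros simp: case_prod_unfold)
  then show ?thesis
    by (simp add: spherical_integral_def[abs_def] spherical_integral_deriv_def)
qed

text \<open>The \<open>r\<close>-derivative \<open>X\<close> of \<open>horo\<close> has derivative
  \<open>horo\<close> again, and its square is \<open>horo\<close> squared minus
  \<open>sin t\<close> squared. Hence the second derivative of the integrand contains no
  \<open>X\<close>.\<close>

lemma has_vector_derivative_spherical_integral_deriv:
  "(spherical_integral_deriv k a has_vector_derivative
     integral {0..pi} (\<lambda>t. (a\<^sup>2 * horo_cpow (- a) r t
       - a * (a + 1) * of_real ((sin t)\<^sup>2) * horo_cpow (- a - 2) r t) * of_real (sin t ^ (k - 1)))) (at r)"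
proof -
  have "((\<lambda>r. integral (cbox 0 pi) (\<lambda>t. - a * of_real (sinh r - cosh r * cos t) * horo_cpow (- a - 1) r t * of_real (sin t ^ (k - 1)))) has_vector_derivative
     integral (cbox 0 pi) (\<lambda>t. (a\<^sup>2 * horo_cpow (- a) r t
       - a * (a + 1) * of_real ((sin t)\<^sup>2) * horo_cpow (- a - 2) r t) * of_real (sin t ^ (k - 1))))
     (at r within UNIV)"
  proof (rule leibniz_rule_vector_derivative)
    fix r t :: real
    define X H S Z where "X = complex_of_real (sinh r - cosh r * cos t)" and "H = complex_of_real (horo r t)"
      and "S = complex_of_real ((sin t)\<^sup>2)" and "Z = horo_cpow (- a - 2) r t"
    have H1: "horo_cpow (- a - 1) r t = H * Z" and H2: "horo_cpow (- a) r t = H\<^sup>2 * Z"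
      using horo_cpow_plus_1[of "- a - 2" r t] horo_cpow_plus_1[of "- a - 1" r t]
      by (simp_all add: power2_eq_square minus_diff_commute H_def Z_def)
    have "(sinh r - cosh r * cos t)\<^sup>2 - (horo r t)\<^sup>2 =
        ((cosh r)\<^sup>2 - (sinh r)\<^sup>2) * ((cos t)\<^sup>2 - 1)"
      by (simp add: horo_def power2_eq_square algebra_simps)
    then have "(sinh r - cosh r * cos t)\<^sup>2 = (horo r t)\<^sup>2 - (sin t)\<^sup>2"
      by (simp add: hyperbolic_pythagoras cos_squared_eq)
    then have X2: "X\<^sup>2 = H\<^sup>2 - S"
      unfolding X_def H_def S_def by (metis of_real_diff of_real_power)
    have "X * ((- a - 1) * X * Z) + H * (H * Z) = ((- a - 1) * X\<^sup>2 + H\<^sup>2) * Z"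
      by (simp add: power2_eq_square algebra_simps)
    also have "\<dots> = (S * (a + 1) - a * H\<^sup>2) * Z"
      unfolding X2 by (simp add: algebra_simps)
    finally have eq: "X * ((- a - 1) * X * Z) + H * (H * Z) = (S * (a + 1) - a * H\<^sup>2) * Z" .
    have A: "((\<lambda>r. horo_cpow (- a - 1) r t) has_vector_derivative (- a - 1) * X * Z) (at r)"
      using has_vector_derivative_horo_cpow[of "\<lambda>r. r" 1 r UNIV "\<lambda>_. t" 0 "- a - 1"]
      by (simp add: X_def Z_def diff_diff_add)
    have B: "((\<lambda>r. complex_of_real (sinh r - cosh r * cos t)) has_vector_derivative H) (at r)"
      unfolding H_def
      by (intro has_vector_derivative_of_real)
         (auto intro!: derivative_eq_intros simp: has_real_derivative_iff_has_vector_derivative[symmetric] horo_def)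
    have D: "((\<lambda>r. of_real (sinh r - cosh r * cos t) * horo_cpow (- a - 1) r t) has_vector_derivative
      (S * (a + 1) - a * H\<^sup>2) * Z) (at r)"
      using has_vector_derivative_mult[OF B A] by (simp only: X_def[symmetric] H1 eq)
    have "- a * ((S * (a + 1) - a * H\<^sup>2) * Z) = a\<^sup>2 * horo_cpow (- a) r t
       - a * (a + 1) * of_real ((sin t)\<^sup>2) * horo_cpow (- a - 2) r t"
      unfolding H2 S_def[symmetric] Z_def[symmetric] by (simp add: power2_eq_square algebra_simps)
    from has_vector_derivative_mult_left[OF has_vector_derivative_mult_right[OF D, of "- a", unfolded this],
      of "of_real (sin t ^ (k - 1))"]
    show "((\<lambda>r. - a * of_real (sinh r - cosh r * cos t) * horo_cpow (- a - 1) r t * of_real (sin t ^ (k - 1))) has_vector_derivative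
       (a\<^sup>2 * horo_cpow (- a) r t
       - a * (a + 1) * of_real ((sin t)\<^sup>2) * horo_cpow (- a - 2) r t) * of_real (sin t ^ (k - 1)))
       (at r within UNIV)"
      by (simp only: mult.assoc)
  qed (auto intro!: integrable_continuous_real continuous_intros simp: case_prod_unfold)
  then show ?thesis
    by (simp add: spherical_integral_deriv_def[abs_def])
qed

section \<open>The radial equation for the integrals and its symmetry in the exponent\<close>

text \<open>
  For \<open>b = - a - 1\<close> and up to the factor \<open>a / sinh r\<close>, this integrand is the defect of the
  integrand of \<open>spherical_integral\<close> in the radial equation; it is the derivative in \<open>t\<close> of
  \<open>horo_cpow b r t\<close> times the \<open>k\<close>-th power of \<open>sin t\<close>.
\<close>

lemma spherical_integral_boundary_term:
  assumes "k \<ge> 1"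
  shows "((\<lambda>t. of_real (sinh r) * b * of_real ((sin t)\<^sup>2) * horo_cpow (b - 1) r t * of_real (sin t ^ (k - 1))
      + of_real (real k * cos t) * horo_cpow b r t * of_real (sin t ^ (k - 1))) has_integral 0) {0..pi}"
proof -
  have "((\<lambda>t. horo_cpow b r t * of_real (sin t ^ k)) has_vector_derivative
     of_real (sinh r) * b * of_real ((sin t)\<^sup>2) * horo_cpow (b - 1) r t * of_real (sin t ^ (k - 1))
      + of_real (real k * cos t) * horo_cpow b r t * of_real (sin t ^ (k - 1))) (at t within {0..pi})" for t
  proof -
    have "((\<lambda>t. sin t ^ k) has_real_derivative real k * sin t ^ (k - 1) * cos t) (at t within {0..pi})"
      by (auto intro!: derivative_eq_intros)
    then have "((\<lambda>t. complex_of_real (sin t ^ k)) has_vector_derivative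
      of_real (real k * sin t ^ (k - 1) * cos t)) (at t within {0..pi})"
      by (intro has_vector_derivative_of_real) (simp add: has_real_derivative_iff_has_vector_derivative)
    from has_vector_derivative_mult[OF has_vector_derivative_horo_cpow[of "\<lambda>_. r" 0 t _ "\<lambda>t. t" 1 b] this]
    have "((\<lambda>t. horo_cpow b r t * of_real (sin t ^ k)) has_vector_derivative
      horo_cpow b r t * of_real (real k * sin t ^ (k - 1) * cos t)
      + b * of_real (sinh r * sin t) * horo_cpow (b - 1) r t * of_real (sin t ^ k)) (at t within {0..pi})"
      by (simp add: mult.assoc)
    moreover have "sin t ^ k = sin t * sin t ^ (k - 1)" using assms by (cases k) auto
    ultimately show ?thesis
      by (simp add: power2_eq_square algebra_simps)
  qed
  \<comment> \<open>The primitive vanishes at both ends, since \<open>sin\<close> does and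
    \<open>k \<ge> 1\<close>.\<close>
  from fundamental_theorem_of_calculus[OF _ this]
  show ?thesis using assms by (simp add: power_0_left)
qed

lemma integrable_horo_cpow:
  "(\<lambda>t. horo_cpow a r t * of_real (sin t ^ k)) integrable_on {0..pi}"
  by (intro integrable_continuous_real continuous_intros)

text \<open>The defect in the radial equation is a multiple of an exact \<open>t\<close>-derivative,
  so it integrates to 0. At \<open>r = 0\<close> all powers of \<open>horo\<close> equal 1, which
  makes the initial value independent of \<open>a\<close>.\<close>

lemma regular_solution_spherical_integral:
  assumes "k \<ge> 1"
  shows "regular_solution k (a * of_nat k - a\<^sup>2) (of_real (integral {0..pi} (\<lambda>t. sin t ^ (k - 1))))
    (spherical_integral k a) (spherical_integral_deriv k a)"
proof -
  have ode: "(spherical_integral_deriv k a has_vector_derivative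
      - (of_real (real k * (cosh r / sinh r)) * spherical_integral_deriv k a r
         + (a * of_nat k - a\<^sup>2) * spherical_integral k a r)) (at r)" if "r > 0" for r
  proof -
    define c l where "c = complex_of_real (real k * (cosh r / sinh r))" and "l = a * of_nat k - a\<^sup>2"
    define d0 where "d0 t = horo_cpow (- a) r t * of_real (sin t ^ (k - 1))" for t
    define d1 where "d1 t = - a * of_real (sinh r - cosh r * cos t) * horo_cpow (- a - 1) r t
      * of_real (sin t ^ (k - 1))" for t
    define d2 where "d2 t = (a\<^sup>2 * horo_cpow (- a) r t
       - a * (a + 1) * of_real ((sin t)\<^sup>2) * horo_cpow (- a - 2) r t) * of_real (sin t ^ (k - 1))" for t
    have "d0 integrable_on {0..pi}" "d1 integrable_on {0..pi}" "d2 integrable_on {0..pi}"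
      unfolding d0_def d1_def d2_def by (intro integrable_continuous_real continuous_intros)+
    then have 1: "((\<lambda>t. d2 t + (c * d1 t + l * d0 t)) has_integral
        integral {0..pi} d2 + (c * integral {0..pi} d1 + l * integral {0..pi} d0)) {0..pi}"
      by (intro has_integral_add has_integral_mult_right integrable_integral)
    have "d2 t + (c * d1 t + l * d0 t) = a / of_real (sinh r) *
        (of_real (sinh r) * (- a - 1) * of_real ((sin t)\<^sup>2) * horo_cpow (- a - 1 - 1) r t * of_real (sin t ^ (k - 1))
      + of_real (real k * cos t) * horo_cpow (- a - 1) r t * of_real (sin t ^ (k - 1)))" for t
    proof -
      define X Z where "X = horo_cpow (- a - 1) r t" and "Z = horo_cpow (- a - 2) r t"
      have "horo_cpow (- a) r t = of_real (horo r t) * X"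
        using horo_cpow_plus_1[of "- a - 1" r t] by (simp add: X_def)
      moreover have "real k * horo r t - real k * (cosh r / sinh r) * (sinh r - cosh r * cos t)
          = real k * cos t / sinh r"
      proof -
        have "sinh r \<noteq> 0" using \<open>r > 0\<close> by simp
        have "real k * horo r t - real k * (cosh r / sinh r) * (sinh r - cosh r * cos t)
          = real k * cos t * ((cosh r)\<^sup>2 - (sinh r)\<^sup>2) / sinh r"
          using \<open>sinh r \<noteq> 0\<close> by (simp add: horo_def field_simps power2_eq_square)
        then show ?thesis by (simp add: hyperbolic_pythagoras)
      qed
      then have "of_nat k * of_real (horo r t) - c * of_real (sinh r - cosh r * cos t)
          = of_real (real k * cos t / sinh r)"
        unfolding c_def by (metis of_real_diff of_real_mult of_real_of_nat_eq)
      \<comment> \<open>The \<open>a\<^sup>2\<close> of the second derivative cancels the one in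
        \<open>l\<close>. What remains is \<open>K * H - c * V\<close>, just reduced to
        \<open>k * cos t / sinh r\<close>.\<close>
      moreover have "(a\<^sup>2 * (H * X) - a * (a + 1) * S * Z) * Y + (c * (- a * V * X * Y) + l * (H * X * Y))
        = (a * (K * H - c * V) * X - a * (a + 1) * S * Z) * Y" if "l = a * K - a\<^sup>2" for H V Y S K
        unfolding that by (simp add: algebra_simps)
      ultimately have "d2 t + (c * d1 t + l * d0 t) =
         (a * of_real (real k * cos t / sinh r) * X - a * (a + 1) * of_real ((sin t)\<^sup>2) * Z)
          * of_real (sin t ^ (k - 1))"
        unfolding d0_def d1_def d2_def X_def[symmetric] Z_def[symmetric] using l_def by metis
      also have "\<dots> = a / of_real (sinh r) *
        (of_real (sinh r) * (- a - 1) * of_real ((sin t)\<^sup>2) * Z * of_real (sin t ^ (k - 1))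
      + of_real (real k * cos t) * X * of_real (sin t ^ (k - 1)))"
        using \<open>r > 0\<close> by (simp add: field_simps)
      finally show ?thesis by (simp add: X_def Z_def diff_diff_add)
    qed
    moreover have "((\<lambda>t. a / of_real (sinh r) *
        (of_real (sinh r) * (- a - 1) * of_real ((sin t)\<^sup>2) * horo_cpow (- a - 1 - 1) r t * of_real (sin t ^ (k - 1))
      + of_real (real k * cos t) * horo_cpow (- a - 1) r t * of_real (sin t ^ (k - 1)))) has_integral
        a / of_real (sinh r) * 0) {0..pi}"
      by (intro has_integral_mult_right spherical_integral_boundary_term assms)
    ultimately have "integral {0..pi} d2 + (c * integral {0..pi} d1 + l * integral {0..pi} d0) = 0"
      using has_integral_unique[OF 1] by simp
    then have "integral {0..pi} d2 = - (c * spherical_integral_deriv k a r + l * spherical_integral k a r)"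
      unfolding spherical_integral_def spherical_integral_deriv_def d0_def[symmetric] d1_def[symmetric]
      by (simp only: eq_neg_iff_add_eq_0)
    then show ?thesis
      using has_vector_derivative_spherical_integral_deriv[of k a r]
      unfolding c_def l_def d2_def by simp
  qed
  have 1: "horo_cpow b 0 t = 1" for b t
    by (simp add: horo_cpow_def horo_def)
  have "spherical_integral k a 0 = of_real (integral {0..pi} (\<lambda>t. sin t ^ (k - 1)))"
    unfolding spherical_integral_def 1 mult_1_left
    by (rule integral_unique, rule has_integral_of_real, rule integrable_integral)
       (intro integrable_continuous_real continuous_intros)
  moreover have "spherical_integral_deriv k a 0 = 0"
  proof -
    \<comment> \<open>The boundary term lemma at \<open>r = 0\<close>, \<open>b = 1\<close>: the
      factor \<open>sinh 0\<close> removes its first summand, and the integral of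
      \<open>k * cos t * sin t ^ (k - 1)\<close> is left.\<close>
    have "((\<lambda>t. a / of_nat k * (of_real (real k * cos t) * of_real (sin t ^ (k - 1)))) has_integral a / of_nat k * 0) {0..pi}"
      using spherical_integral_boundary_term[OF assms, of 0 1] unfolding 1
      by (intro has_integral_mult_right) simp
    then show ?thesis
      using assms by (auto dest!: integral_unique simp: spherical_integral_deriv_def 1 mult.assoc)
  qed
  moreover have "(spherical_integral k a \<longlongrightarrow> spherical_integral k a 0) (at_right 0)"
    "(spherical_integral_deriv k a \<longlongrightarrow> spherical_integral_deriv k a 0) (at_right 0)"
    using has_vector_derivative_spherical_integral[of k a 0]
      has_vector_derivative_spherical_integral_deriv[of k a 0]
    by (auto dest!: has_vector_derivative_continuous simp: continuous_at intro: tendsto_within_subset)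
  ultimately show ?thesis
    unfolding regular_solution_def
    using has_vector_derivative_spherical_integral ode by auto
qed

text \<open>
  The exponents \<open>a\<close> and \<open>k - a\<close> share their eigenvalue, so by uniqueness they define the same
  function; averaging the two integrals produces the hyperbolic cosine.
\<close>

lemma spherical_integral_eq_cosh:
  assumes "k \<ge> 1" and "r > 0"
  shows "((\<lambda>t. of_real (exp (- (real k / 2) * ln (horo r t)) * sin t ^ (k - 1)) *
      cosh ((a - of_nat k / 2) * of_real (ln (horo r t)))) has_integral spherical_integral k a r) {0..pi}"
proof -
  have "spherical_integral k (of_nat k - a) r = spherical_integral k a r"
    using regular_solution_unique[OF _ _ \<open>r > 0\<close>]
      regular_solution_spherical_integral[OF \<open>k \<ge> 1\<close>, of a]
      regular_solution_spherical_integral[OF \<open>k \<ge> 1\<close>, of "of_nat k - a"]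
    by (simp add: power2_eq_square algebra_simps)
  then have "((\<lambda>t. (horo_cpow (- a) r t * of_real (sin t ^ (k - 1))
      + horo_cpow (- (of_nat k - a)) r t * of_real (sin t ^ (k - 1))) / 2) has_integral
      (spherical_integral k a r + spherical_integral k a r) / 2) {0..pi}"
    using integrable_integral[OF integrable_horo_cpow]
    unfolding spherical_integral_def
    by (intro has_integral_divide has_integral_add) metis+
  moreover have "(horo_cpow (- a) r t * Y + horo_cpow (- (of_nat k - a)) r t * Y) / 2
    = of_real (exp (- (real k / 2) * ln (horo r t))) * Y *
      cosh ((a - of_nat k / 2) * of_real (ln (horo r t)))" for t Y
  proof -
    define s where "s = complex_of_real (ln (horo r t))"
    \<comment> \<open>The exponents \<open>- a\<close> and \<open>- (k - a)\<close> lie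
      symmetrically about \<open>- k / 2\<close>; splitting off that centre leaves two opposite
      exponentials.\<close>
    have "exp (- a * s) = exp (- (of_nat k / 2) * s) * exp (- ((a - of_nat k / 2) * s))"
      and "exp (- (of_nat k - a) * s) = exp (- (of_nat k / 2) * s) * exp ((a - of_nat k / 2) * s)"
      by (simp_all add: exp_add[symmetric] algebra_simps)
    moreover have "of_real (exp (- (real k / 2) * ln (horo r t))) = exp (- (of_nat k / 2) * s)"
      by (simp add: exp_of_real[symmetric] s_def)
    ultimately show ?thesis
      by (simp add: horo_cpow_def s_def[symmetric] cosh_field_def algebra_simps)
  qed
  ultimately show ?thesis by simp
qed

subsection \<open>Comparison of two eigenfunctions\<close>

text \<open>As long as the imaginary part of \<open>w * s\<close> stays within pi/2, the real and
  imaginary parts of \<open>sinh (w * s)\<close> keep the signs of those of \<open>w\<close>. Of the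
  real and imaginary parts of the product, at least one is then a sum of two terms of non-opposite
  signs; \<open>e\<close>, which does not depend on \<open>s\<close>, selects that part and its
  sign.\<close>

lemma sinh_mult_product_halfplane:
  fixes u v :: complex
  assumes "u \<noteq> 0" and "v \<noteq> 0"
  obtains e :: complex where
    "\<And>s. s > 0 \<Longrightarrow> \<bar>Im u\<bar> * s \<le> pi / 2 \<Longrightarrow> \<bar>Im v\<bar> * s \<le> pi / 2 \<Longrightarrow>
       Re (e * (sinh (u * of_real s) * sinh (v * of_real s))) \<ge> 0"
    "\<And>s. s > 0 \<Longrightarrow> \<bar>Im u\<bar> * s < pi / 2 \<Longrightarrow> \<bar>Im v\<bar> * s < pi / 2 \<Longrightarrow>
       Re (e * (sinh (u * of_real s) * sinh (v * of_real s))) > 0"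
proof -
  have rep: "\<exists>P Q. P \<ge> 0 \<and> (\<bar>Im w\<bar> * s < pi / 2 \<longrightarrow> P > 0) \<and> Q > 0 \<and>
      sinh (w * of_real s) = Complex (Re w * P) (Im w * Q)"
    if "s > 0" "\<bar>Im w\<bar> * s \<le> pi / 2" for w s
  proof -
    \<comment> \<open>When \<open>Re w = 0\<close> the first factor of \<open>P\<close> is
      irrelevant, as \<open>P\<close> is multiplied by \<open>Re w\<close>; \<open>s\<close> is a
      convenient positive value. The same holds for \<open>Q\<close> and \<open>Im w\<close>. At the
      limit angle pi/2 the cosine makes \<open>P\<close> vanish but \<open>Q\<close> stays positive,
      hence the two strengths of the claim.\<close>
    define P where "P = (if Re w = 0 then s else sinh (Re w * s) / Re w) * cos (Im w * s)"
    define Q where "Q = (if Im w = 0 then s else sin (Im w * s) / Im w) * cosh (Re w * s)"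
    have "sinh (Re w * s) / Re w > 0" if "Re w \<noteq> 0"
      using that \<open>s > 0\<close> by (cases "Re w > 0") (auto simp: zero_less_divide_iff mult_less_0_iff)
    then have f: "(if Re w = 0 then s else sinh (Re w * s) / Re w) > 0" using \<open>s > 0\<close> by auto
    have a: "\<bar>Im w * s\<bar> = \<bar>Im w\<bar> * s" using that by (simp add: abs_mult)
    have P: "P \<ge> 0" unfolding P_def using f that a
      by (intro mult_nonneg_nonneg cos_ge_zero) (auto simp: abs_le_iff)
    have P': "P > 0" if "\<bar>Im w\<bar> * s < pi / 2" unfolding P_def using f that a
      by (intro mult_pos_pos cos_gt_zero_pi) (auto simp: abs_less_iff)
    have "sin (Im w * s) / Im w > 0" if "Im w \<noteq> 0"
    proof -
      have "sin (\<bar>Im w\<bar> * s) > 0"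
        using that \<open>s > 0\<close> \<open>\<bar>Im w\<bar> * s \<le> pi / 2\<close> pi_gt_zero
        by (intro sin_gt_zero) (auto simp del: pi_gt_zero)
      then show ?thesis using that by (cases "Im w > 0") (auto simp: zero_less_divide_iff)
    qed
    then have Q: "Q > 0" unfolding Q_def using \<open>s > 0\<close> by auto
    have "Re (sinh (w * of_real s)) = sinh (Re w * s) * cos (Im w * s)"
      by (simp add: sinh_def Re_exp Im_exp algebra_simps)
    moreover have "Im (sinh (w * of_real s)) = cosh (Re w * s) * sin (Im w * s)"
      by (simp add: sinh_def cosh_def Re_exp Im_exp algebra_simps)
    ultimately have "sinh (w * of_real s) = Complex (Re w * P) (Im w * Q)"
      by (auto simp: complex_eq_iff P_def Q_def)
    with P P' Q show ?thesis by blast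
  qed
  define A B C D where "A = Re u * Im v" and "B = Im u * Re v"
    and "C = Re u * Re v" and "D = - (Im u * Im v)"
  \<comment> \<open>Two numbers with nonnegative product, not both 0, have
    \<open>sgn (a + b)\<close> as common sign.\<close>
  have combine: "0 \<le> sgn (a + b) * (a * x + b * y)"
      "x > 0 \<Longrightarrow> y > 0 \<Longrightarrow> 0 < sgn (a + b) * (a * x + b * y)"
    if "a * b \<ge> 0" "a \<noteq> 0 \<or> b \<noteq> 0" "x \<ge> 0" "y \<ge> 0" for a b x y :: real
  proof -
    have "sgn (a + b) * a = \<bar>a\<bar>" "sgn (a + b) * b = \<bar>b\<bar>"
      using that by (auto simp: sgn_if zero_le_mult_iff)
    then have eq: "sgn (a + b) * (a * x + b * y) = \<bar>a\<bar> * x + \<bar>b\<bar> * y"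
      by (simp add: distrib_left mult.assoc[symmetric])
    show "0 \<le> sgn (a + b) * (a * x + b * y)"
      unfolding eq using that by simp
    show "0 < sgn (a + b) * (a * x + b * y)" if "x > 0" "y > 0"
      unfolding eq using that \<open>a \<noteq> 0 \<or> b \<noteq> 0\<close>
      by (cases "a = 0") (auto intro!: add_pos_nonneg)
  qed
  have prod: "\<exists>x y z w. (x \<ge> 0 \<and> y \<ge> 0 \<and> z \<ge> 0 \<and> w \<ge> 0) \<and>
      (\<bar>Im u\<bar> * s < pi / 2 \<longrightarrow> \<bar>Im v\<bar> * s < pi / 2 \<longrightarrow> x > 0 \<and> y > 0 \<and> z > 0 \<and> w > 0) \<and>
      sinh (u * of_real s) * sinh (v * of_real s) = Complex (C * x + D * y) (A * z + B * w)"
    if s: "s > 0" "\<bar>Im u\<bar> * s \<le> pi / 2" "\<bar>Im v\<bar> * s \<le> pi / 2" for s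
  proof -
    obtain P Q where 1: "P \<ge> 0" "\<bar>Im u\<bar> * s < pi / 2 \<longrightarrow> P > 0" "Q > 0"
      "sinh (u * of_real s) = Complex (Re u * P) (Im u * Q)" using rep[OF s(1,2)] by blast
    obtain P' Q' where 2: "P' \<ge> 0" "\<bar>Im v\<bar> * s < pi / 2 \<longrightarrow> P' > 0" "Q' > 0"
      "sinh (v * of_real s) = Complex (Re v * P') (Im v * Q')" using rep[OF s(1,3)] by blast
    have "sinh (u * of_real s) * sinh (v * of_real s) =
        Complex (C * (P * P') + D * (Q * Q')) (A * (P * Q') + B * (Q * P'))"
      unfolding 1(4) 2(4) by (simp add: complex_eq_iff A_def B_def C_def D_def mult_ac)
    moreover have "P * P' \<ge> 0 \<and> Q * Q' \<ge> 0 \<and> P * Q' \<ge> 0 \<and> Q * P' \<ge> 0"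
      using 1 2 by simp
    moreover have "P * P' > 0 \<and> Q * Q' > 0 \<and> P * Q' > 0 \<and> Q * P' > 0"
      if "\<bar>Im u\<bar> * s < pi / 2" "\<bar>Im v\<bar> * s < pi / 2"
      using 1 2 that by simp
    ultimately show ?thesis by blast
  qed
  \<comment> \<open>The two products are opposite, so one of them is positive or both are 0; in the
    latter case a pair that is not identically 0 is chosen.\<close>
  have "(A * B \<ge> 0 \<and> (A \<noteq> 0 \<or> B \<noteq> 0)) \<or> (C * D \<ge> 0 \<and> (C \<noteq> 0 \<or> D \<noteq> 0))"
  proof -
    have "A * B = - (C * D)" by (simp add: A_def B_def C_def D_def)
    moreover have "A \<noteq> 0 \<or> B \<noteq> 0 \<or> C \<noteq> 0 \<or> D \<noteq> 0"
      using assms by (auto simp: A_def B_def C_def D_def complex_eq_iff)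
    ultimately show ?thesis by (smt (verit) mult_eq_0_iff)
  qed
  then show ?thesis
  proof
    assume *: "A * B \<ge> 0 \<and> (A \<noteq> 0 \<or> B \<noteq> 0)"
    show ?thesis
    \<comment> \<open>The factor \<open>- \<i>\<close> turns the imaginary part into the real
      part.\<close>
    proof (rule that[of "- \<i> * of_real (sgn (A + B))"])
      fix s :: real assume "s > 0" "\<bar>Im u\<bar> * s \<le> pi / 2" "\<bar>Im v\<bar> * s \<le> pi / 2"
      from prod[OF this] combine(1)[of A B] *
      show "Re (- \<i> * of_real (sgn (A + B)) * (sinh (u * of_real s) * sinh (v * of_real s))) \<ge> 0"
        by fastforce
    next
      fix s :: real assume "s > 0" "\<bar>Im u\<bar> * s < pi / 2" "\<bar>Im v\<bar> * s < pi / 2"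
      with prod[of s] combine(2)[of A B] *
      show "Re (- \<i> * of_real (sgn (A + B)) * (sinh (u * of_real s) * sinh (v * of_real s))) > 0"
        by fastforce
    qed
  next
    assume *: "C * D \<ge> 0 \<and> (C \<noteq> 0 \<or> D \<noteq> 0)"
    show ?thesis
    proof (rule that[of "of_real (sgn (C + D))"])
      fix s :: real assume "s > 0" "\<bar>Im u\<bar> * s \<le> pi / 2" "\<bar>Im v\<bar> * s \<le> pi / 2"
      from prod[OF this] combine(1)[of C D] *
      show "Re (of_real (sgn (C + D)) * (sinh (u * of_real s) * sinh (v * of_real s))) \<ge> 0"
        by fastforce
    next
      fix s :: real assume "s > 0" "\<bar>Im u\<bar> * s < pi / 2" "\<bar>Im v\<bar> * s < pi / 2"
      with prod[of s] combine(2)[of C D] *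
      show "Re (of_real (sgn (C + D)) * (sinh (u * of_real s) * sinh (v * of_real s))) > 0"
        by fastforce
    qed
  qed
qed

section \<open>The difference of two horospherical integrals\<close>

lemma cosh_diff_cosh:
  fixes x y :: complex
  shows "cosh x - cosh y = 2 * (sinh ((x + y) / 2) * sinh ((x - y) / 2))"
proof -
  have "cosh ((x + y) / 2 + (x - y) / 2) - cosh ((x + y) / 2 - (x - y) / 2)
    = 2 * (sinh ((x + y) / 2) * sinh ((x - y) / 2))"
    unfolding cosh_add cosh_diff by simp
  moreover have "(x + y) / 2 + (x - y) / 2 = x" "(x + y) / 2 - (x - y) / 2 = y"
    by (simp_all add: field_simps)
  ultimately show ?thesis by simp
qed

text \<open>If the integrals agreed, rotating their difference by \<open>e\<close> and taking real
  parts would give a continuous nonnegative integrand \<open>q\<close> with integral 0, hence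
  \<open>q = 0\<close> throughout; but \<open>q\<close> is positive at
  \<open>t = pi / 2\<close>.\<close>

lemma spherical_integral_neq:
  assumes "k \<ge> 1" and "r > 0"
    and "a * of_nat k - a\<^sup>2 \<noteq> b * of_nat k - b\<^sup>2"
    and a: "\<bar>Im a\<bar> * r \<le> pi / 2" and b: "\<bar>Im b\<bar> * r \<le> pi / 2"
  shows "spherical_integral k a r \<noteq> spherical_integral k b r"
proof
  assume eq: "spherical_integral k a r = spherical_integral k b r"
  \<comment> \<open>Half the sum and half the difference of the centred exponents
    \<open>a - k / 2\<close> and \<open>b - k / 2\<close>. Up to sign, \<open>4 * (u * v)\<close> is
    the difference of the eigenvalues, so neither factor vanishes.\<close>
  define u v where "u = (a + b - of_nat k) / 2" and "v = (a - b) / 2"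
  have "4 * (u * v) = (b * of_nat k - b\<^sup>2) - (a * of_nat k - a\<^sup>2)"
    by (simp add: u_def v_def power2_eq_square field_simps)
  then have "u \<noteq> 0" "v \<noteq> 0" using assms(3) by auto
  then obtain e where e0:
    "\<And>s. s > 0 \<Longrightarrow> \<bar>Im u\<bar> * s \<le> pi / 2 \<Longrightarrow> \<bar>Im v\<bar> * s \<le> pi / 2 \<Longrightarrow>
       Re (e * (sinh (u * of_real s) * sinh (v * of_real s))) \<ge> 0"
    and e1:
    "\<And>s. s > 0 \<Longrightarrow> \<bar>Im u\<bar> * s < pi / 2 \<Longrightarrow> \<bar>Im v\<bar> * s < pi / 2 \<Longrightarrow>
       Re (e * (sinh (u * of_real s) * sinh (v * of_real s))) > 0"
    using sinh_mult_product_halfplane by blast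
  have "\<bar>Im u\<bar> \<le> (\<bar>Im a\<bar> + \<bar>Im b\<bar>) / 2" "\<bar>Im v\<bar> \<le> (\<bar>Im a\<bar> + \<bar>Im b\<bar>) / 2"
    by (auto simp: u_def v_def)
  then have uv: "\<bar>Im u\<bar> * r \<le> pi / 2" "\<bar>Im v\<bar> * r \<le> pi / 2"
    using a b mult_right_mono[of "\<bar>Im u\<bar>" "(\<bar>Im a\<bar> + \<bar>Im b\<bar>) / 2" r]
      mult_right_mono[of "\<bar>Im v\<bar>" "(\<bar>Im a\<bar> + \<bar>Im b\<bar>) / 2" r] \<open>r > 0\<close>
    by (auto simp: field_simps)
  define p where "p s = Re (e * (sinh (u * of_real s) * sinh (v * of_real s)))" for s
  \<comment> \<open>Both \<open>sinh\<close> factors are odd; thus negative values of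
    \<open>ln (horo r t)\<close> reduce to positive ones.\<close>
  have p_even: "p \<bar>s\<bar> = p s" for s
    by (simp add: p_def abs_if)
  have p_nonneg: "p s \<ge> 0" if "\<bar>s\<bar> \<le> r" for s
  proof (cases "s = 0")
    case False
    then have "p \<bar>s\<bar> \<ge> 0"
      unfolding p_def using uv mult_left_mono[OF that, of "\<bar>Im u\<bar>"] mult_left_mono[OF that, of "\<bar>Im v\<bar>"]
      by (intro e0) auto
    then show ?thesis by (simp add: p_even)
  qed (simp add: p_def)
  \<comment> \<open>For \<open>s < r\<close> the angle bounds become strict even if they are
    equalities at \<open>r\<close>. This is what admits the right endpoint of the interval.\<close>
  have p_pos: "p s > 0" if "0 < s" "s < r" for s
  proof -
    have "x * s < pi / 2" if "x \<ge> 0" "x * r \<le> pi / 2" for x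
    proof (cases "x = 0")
      case False
      then have "x * s < x * r" using \<open>s < r\<close> that by simp
      then show ?thesis using that by simp
    qed simp
    then show ?thesis unfolding p_def using uv that by (intro e1) auto
  qed
  define w where "w t = exp (- (real k / 2) * ln (horo r t)) * sin t ^ (k - 1)" for t
  define q where "q t = w t * (2 * p (ln (horo r t)))" for t
  have "((\<lambda>t. of_real (w t) * cosh ((a - of_nat k / 2) * of_real (ln (horo r t)))
        - of_real (w t) * cosh ((b - of_nat k / 2) * of_real (ln (horo r t)))) has_integral 0) {0..pi}"
    using has_integral_diff[OF spherical_integral_eq_cosh[OF assms(1,2), of a]
        spherical_integral_eq_cosh[OF assms(1,2), of b]] eq by (simp add: w_def)
  then have int: "((\<lambda>t. e * (of_real (w t) * cosh ((a - of_nat k / 2) * of_real (ln (horo r t)))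
        - of_real (w t) * cosh ((b - of_nat k / 2) * of_real (ln (horo r t))))) has_integral e * 0) {0..pi}"
    by (rule has_integral_mult_right)
  have "Re (e * (of_real (w t) * cosh ((a - of_nat k / 2) * of_real s)
        - of_real (w t) * cosh ((b - of_nat k / 2) * of_real s))) = w t * (2 * p s)" for t s
  proof -
    have "((a - of_nat k / 2) * of_real s + (b - of_nat k / 2) * of_real s) / 2 = u * of_real s"
      and "((a - of_nat k / 2) * of_real s - (b - of_nat k / 2) * of_real s) / 2 = v * of_real s"
      by (simp_all add: u_def v_def field_simps)
    then have eq: "e * (of_real (w t) * cosh ((a - of_nat k / 2) * of_real s)
        - of_real (w t) * cosh ((b - of_nat k / 2) * of_real s))
      = of_real (w t * 2) * (e * (sinh (u * of_real s) * sinh (v * of_real s)))"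
      using cosh_diff_cosh[of "(a - of_nat k / 2) * of_real s" "(b - of_nat k / 2) * of_real s"]
      by (simp add: right_diff_distrib[symmetric])
    have "Re (of_real x * z) = x * Re z" for x z by simp
    then show ?thesis unfolding eq p_def by (simp only: mult.assoc)
  qed
  with has_integral_Re[OF int] have "(q has_integral 0) {0..pi}"
    by (simp only: q_def[abs_def] mult_zero_right zero_complex.sel)
  then have "integral {0..pi} q = 0" by (rule integral_unique)
  moreover have "continuous_on {0..pi} q"
    unfolding q_def w_def p_def by (intro continuous_intros) (simp_all add: horo_pos[THEN less_imp_neq, symmetric])
  moreover have "q t \<ge> 0" if "t \<in> {0..pi}" for t
  proof -
    have "ln (horo r t) \<le> r" "- r \<le> ln (horo r t)"
      using horo_bounds[of r t] \<open>r > 0\<close> horo_pos[of r t]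
        ln_le_cancel_iff[of "horo r t" "exp r"] ln_le_cancel_iff[of "exp (- r)" "horo r t"] by auto
    then show ?thesis
      using that unfolding q_def w_def
      by (intro mult_nonneg_nonneg p_nonneg zero_le_power sin_ge_zero) auto
  qed
  ultimately have "q (pi / 2) = 0"
    using integral_eq_0_iff[of 0 pi q] by auto
  \<comment> \<open>At \<open>t = pi / 2\<close> the weight is positive and \<open>horo r t\<close>
    is \<open>cosh r\<close>, whose logarithm lies strictly between 0 and \<open>r\<close>.\<close>
  moreover have "p (ln (cosh r)) > 0"
  proof (rule p_pos)
    have "cosh r > 1"
      using \<open>r > 0\<close> cosh_real_nonneg_less_iff[of 0 r] by simp
    then show "ln (cosh r) > 0" by simp
    have "cosh r < exp r" using \<open>r > 0\<close> cosh_plus_sinh[of r] by (smt (verit) sinh_real_pos_iff)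
    then show "ln (cosh r) < r" using ln_less_cancel_iff[of "cosh r" "exp r"] by simp
  qed
  ultimately show False by (simp add: q_def w_def horo_def)
qed

section \<open>Return to arbitrary negative curvature\<close>

theorem theorem3p3:
  fixes k :: nat and \<rho> \<kappa> p :: real
    and \<mu> \<nu> \<alpha> \<beta> :: complex
    and \<phi>\<^sub>\<mu> \<phi>\<^sub>\<nu> :: "real \<Rightarrow> complex"
  assumes "k \<ge> 1" and "\<rho> > 0" and "\<kappa> = - 1 / \<rho>\<^sup>2"
    and "DIM('a::euclidean_space) = k + 1"
    and "\<mu> \<noteq> \<nu>"
    and "radial_eigenfunction TYPE('a) \<rho> \<mu> \<phi>\<^sub>\<mu>"
    and "radial_eigenfunction TYPE('a) \<rho> \<nu> \<phi>\<^sub>\<nu>"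
    and "\<phi>\<^sub>\<mu> 0 = 1" and "\<phi>\<^sub>\<nu> 0 = 1"
    and "\<mu> = - complex_of_real \<kappa> * (\<alpha> * of_nat k - \<alpha>\<^sup>2)"
    and "\<nu> = - complex_of_real \<kappa> * (\<beta> * of_nat k - \<beta>\<^sup>2)"
    and "p = max \<bar>Im \<alpha>\<bar> \<bar>Im \<beta>\<bar>"
  shows "\<forall>r \<in> (if p = 0 then {0<..} else {0<..pi * \<rho> / (2 * p)}). \<phi>\<^sub>\<nu> r \<noteq> \<phi>\<^sub>\<mu> r"
proof
  fix r
  assume r: "r \<in> (if p = 0 then {0<..} else {0<..pi * \<rho> / (2 * p)})"
  have "p \<ge> 0" using assms(12) by simp
  define R where "R = r / \<rho>"
  have "r > 0" using r by (auto split: if_splits)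
  then have "R > 0" and r_eq: "r = \<rho> * R" using assms(2) by (auto simp: R_def)
  have "p * R \<le> pi / 2"
    using r \<open>p \<ge> 0\<close> assms(2) by (auto simp: R_def field_simps split: if_splits)
  moreover have "\<bar>Im \<alpha>\<bar> * R \<le> p * R" and "\<bar>Im \<beta>\<bar> * R \<le> p * R"
    using assms(12) \<open>R > 0\<close> by (auto intro: mult_right_mono)
  ultimately have im: "\<bar>Im \<alpha>\<bar> * R \<le> pi / 2" "\<bar>Im \<beta>\<bar> * R \<le> pi / 2" by linarith+
  \<comment> \<open>Rescaling by \<open>\<rho>\<close> cancels the factor \<open>- \<kappa>\<close>,
    so \<open>\<alpha>\<close> and \<open>\<beta>\<close> are directly the exponents of the
    horospherical integrals.\<close>
  have "of_real (\<rho>\<^sup>2) * (- complex_of_real \<kappa> * z) = z" for z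
  proof -
    have "of_real (\<rho>\<^sup>2) * (- complex_of_real \<kappa> * z) = of_real (\<rho>\<^sup>2 * - \<kappa>) * z" by simp
    then show ?thesis using assms(2,3) by simp
  qed
  then have \<mu>: "of_real (\<rho>\<^sup>2) * \<mu> = \<alpha> * of_nat k - \<alpha>\<^sup>2" and \<nu>: "of_real (\<rho>\<^sup>2) * \<nu> = \<beta> * of_nat k - \<beta>\<^sup>2"
    unfolding assms(10,11) by blast+
  have ne: "\<alpha> * of_nat k - \<alpha>\<^sup>2 \<noteq> \<beta> * of_nat k - \<beta>\<^sup>2"
    using assms(5,10,11) by metis
  \<comment> \<open>The common initial value of all the spherical integrals. Scaling the
    eigenfunctions up to it, instead of dividing the integrals by it, lets an equality of
    eigenfunctions pass directly to the integrals.\<close>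
  define W where "W = complex_of_real (integral {0..pi} (\<lambda>t. sin t ^ (k - 1)))"
  have rep: "W * \<phi> r = spherical_integral k a R"
    if eigen: "radial_eigenfunction TYPE('a) \<rho> l \<phi>" and "\<phi> 0 = 1"
      and l: "of_real (\<rho>\<^sup>2) * l = a * of_nat k - a\<^sup>2" for l \<phi> a
  proof -
    obtain g where "regular_solution k (of_real (\<rho>\<^sup>2) * l) (\<phi> 0) (\<lambda>r. \<phi> (\<rho> * r)) g"
      using regular_solution_radial_eigenfunction[OF assms(2,4) eigen] .
    from regular_solution_cmult[OF this, of W]
    have "regular_solution k (a * of_nat k - a\<^sup>2) W (\<lambda>r. W * \<phi> (\<rho> * r)) (\<lambda>r. W * g r)"
      unfolding l \<open>\<phi> 0 = 1\<close> by simp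
    from regular_solution_unique[OF this regular_solution_spherical_integral[OF assms(1), folded W_def] \<open>R > 0\<close>]
    show ?thesis unfolding r_eq .
  qed
  show "\<phi>\<^sub>\<nu> r \<noteq> \<phi>\<^sub>\<mu> r"
    using rep[OF assms(6,8) \<mu>] rep[OF assms(7,9) \<nu>]
      spherical_integral_neq[OF assms(1) \<open>R > 0\<close> ne im] by metis
qed

end
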